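(* (1) If $R$ is a bounded ceer, then $\omega\leq R$. (2) Let $k>1$. There is no partial computable function $\rho(e,x)$ such that, whenever $R_e$ is $k$-bounded, $\rho(e,x)\!\downarrow$ for all $x\in\mathbb N$ and $x\mapsto\rho(e,x)$ witnesses $\omega\leq R_e$.
   Context: A ceer is an equivalence relation on $\mathbb N$ c.e. as a subset of $\mathbb N^2$; $R_1\leq R_2$ means there is a total computable $f$ with $xR_1y\Leftrightarrow f(x)R_2f(y)$ for all $x,y$ (and $f$ is said to witness the reduction). $\omega$ is the identity relation on $\mathbb N$. A ceer is $k$-bounded if each class has at most $k$ elements, and bounded if $k$-bounded for some $k>0$. For $e\in\mathbb N$, $R_e$ is the equivalence relation generated by $\{(x,y):\langle x,y\rangle\in W_e\}$, where $W_e$ is the $e$-th c.e. set and $\langle\cdot,\cdot\rangle$ a computable pairing bijection. *)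

theory Defs
  imports Main "HOL-Library.Nat_Bijection"
begin

text \<open>
  Computability is modelled by Kleene's partial recursive functions on tuples of natural numbers.
  Terms carry no arity: every term denotes a partial function on tuples of every length, where
  components missing from a tuple are read as 0 and superfluous ones are never projected out.
  On tuples of a fixed length each term therefore still denotes a partial recursive function,
  and no term has to be excluded as ill-formed.
\<close>

datatype recf =
    Zero
  | Succ
  | Proj nat
  | Comp recf "recf list"
  | PrimRec recf recf
  | Mu recf

definition arg :: "nat list \<Rightarrow> nat \<Rightarrow> nat" where
  "arg xs i = (if i < length xs then xs ! i else 0)"

text \<open>
  \<open>None\<close> means divergence. Composition is strict in all arguments. Primitive recursion and
  minimisation act on the first component:
  \<open>h(0,ys) = f(ys)\<close>, \<open>h(i+1,ys) = g(i,h(i,ys),ys)\<close>, and \<open>\<mu>n. f(n,xs) = 0\<close>, where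
  \<open>f(i,xs)\<close> has to converge for every \<open>i\<close> below the least zero.
\<close>

primrec rec_eval :: "recf \<Rightarrow> nat list \<Rightarrow> nat option" where
  "rec_eval Zero = (\<lambda>xs. Some 0)"
| "rec_eval Succ = (\<lambda>xs. Some (Suc (arg xs 0)))"
| "rec_eval (Proj i) = (\<lambda>xs. Some (arg xs i))"
| "rec_eval (Comp f gs) =
     (\<lambda>xs. Option.bind (those (map (\<lambda>g. g xs) (map rec_eval gs))) (rec_eval f))"
| "rec_eval (PrimRec f g) =
     (\<lambda>xs. rec_nat (rec_eval f (tl xs))
             (\<lambda>i r. Option.bind r (\<lambda>v. rec_eval g (i # v # tl xs))) (arg xs 0))"
| "rec_eval (Mu f) =
     (\<lambda>xs. let P = (\<lambda>n. rec_eval f (n # xs) = Some 0 \<and> (\<forall>i<n. rec_eval f (i # xs) \<noteq> None))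
           in if \<exists>n. P n then Some (LEAST n. P n) else None)"

definition computable :: "(nat \<Rightarrow> nat) \<Rightarrow> bool" where
  "computable f \<longleftrightarrow> (\<exists>p. \<forall>x. rec_eval p [x] = Some (f x))"

definition partial_computable2 :: "(nat \<Rightarrow> nat \<Rightarrow> nat option) \<Rightarrow> bool" where
  "partial_computable2 \<rho> \<longleftrightarrow> (\<exists>p. \<forall>e x. rec_eval p [e, x] = \<rho> e x)"

primrec code :: "recf \<Rightarrow> nat" where
  "code Zero = prod_encode (0, 0)"
| "code Succ = prod_encode (1, 0)"
| "code (Proj i) = prod_encode (2, i)"
| "code (Comp f gs) = prod_encode (3, prod_encode (code f, list_encode (map code gs)))"
| "code (PrimRec f g) = prod_encode (4, prod_encode (code f, code g))"
| "code (Mu f) = prod_encode (5, code f)"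

lemma inj_code: "inj code"
proof (rule injI)
  show "p = q" if "code p = code q" for p q
    using that
  proof (induction p arbitrary: q)
    case Zero then show ?case by (cases q) (auto simp: prod_encode_eq)
  next
    case Succ then show ?case by (cases q) (auto simp: prod_encode_eq)
  next
    case (Proj i) then show ?case by (cases q) (auto simp: prod_encode_eq)
  next
    case (Comp f gs)
    obtain f' gs' where q: "q = Comp f' gs'"
      using Comp.prems by (cases q) (simp_all add: prod_encode_eq)
    have "code f = code f'" and gs: "map code gs = map code gs'"
      using Comp.prems q by (simp_all add: prod_encode_eq list_encode_eq)
    moreover have "gs = gs'"
      by (rule list.inj_map_strong[OF _ gs]) (rule Comp.IH(2))
    ultimately show ?case
      using Comp.IH(1) q by blast
  next
    case (PrimRec f g) then show ?case by (cases q) (auto simp: prod_encode_eq)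
  next
    case (Mu f) then show ?case by (cases q) (auto simp: prod_encode_eq)
  qed
qed

text \<open>
  The standard effective numbering of the unary partial computable functions; indices that are
  not the code of a term denote the nowhere defined function.
\<close>

definition phi :: "nat \<Rightarrow> nat \<Rightarrow> nat option" where
  "phi e x = (if e \<in> range code then rec_eval (inv code e) [x] else None)"

definition W :: "nat \<Rightarrow> nat set" where
  "W e = {x. phi e x \<noteq> None}"

definition ce :: "nat set \<Rightarrow> bool" where
  "ce A \<longleftrightarrow> (\<exists>e. A = W e)"

text \<open>
  The computable pairing bijection is Cantor's, \<open>prod_encode\<close>. Binary relations on the natural
  numbers are predicates, so the identity ceer \<open>\<omega>\<close> is \<open>(=)\<close>.
\<close>

definition ceer :: "(nat \<Rightarrow> nat \<Rightarrow> bool) \<Rightarrow> bool" where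
  "ceer R \<longleftrightarrow> equivp R \<and> ce {prod_encode (x, y) | x y. R x y}"

abbreviation omega :: "nat \<Rightarrow> nat \<Rightarrow> bool" where
  "omega \<equiv> (=)"

definition witnesses :: "(nat \<Rightarrow> nat) \<Rightarrow> (nat \<Rightarrow> nat \<Rightarrow> bool) \<Rightarrow> (nat \<Rightarrow> nat \<Rightarrow> bool) \<Rightarrow> bool" where
  "witnesses f R S \<longleftrightarrow> computable f \<and> (\<forall>x y. R x y \<longleftrightarrow> S (f x) (f y))"

definition reducible :: "(nat \<Rightarrow> nat \<Rightarrow> bool) \<Rightarrow> (nat \<Rightarrow> nat \<Rightarrow> bool) \<Rightarrow> bool" where
  "reducible R S \<longleftrightarrow> (\<exists>f. witnesses f R S)"

definition k_bounded :: "nat \<Rightarrow> (nat \<Rightarrow> nat \<Rightarrow> bool) \<Rightarrow> bool" where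
  "k_bounded k R \<longleftrightarrow> (\<forall>x. finite {y. R x y} \<and> card {y. R x y} \<le> k)"

definition bounded_rel :: "(nat \<Rightarrow> nat \<Rightarrow> bool) \<Rightarrow> bool" where
  "bounded_rel R \<longleftrightarrow> (\<exists>k>0. k_bounded k R)"

definition ceer_of :: "nat \<Rightarrow> nat \<Rightarrow> nat \<Rightarrow> bool" where
  "ceer_of e = equivclp (\<lambda>x y. prod_encode (x, y) \<in> W e)"

end

theory Submission
  imports Defs
begin

text \<open>
  For (1), since class sizes are bounded, there is an \<open>m\<close> such that infinitely many classes have
  at least \<open>m\<close> elements, but only finitely many have more. Beyond a bound \<open>b\<close>, an element with
  \<open>m\<close> enumerated equivalents has its whole class enumerated. Hence one can search
  for infinitely many such elements, each beyond all the classes found before. Searching through an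
  enumeration needs stagewise approximations of a partial recursive function; as only one fixed
  term has to be approximated, these are built by recursion on the term, without a universal
  function.

  For (2), the recursion theorem gives an \<open>e\<close> such that \<open>R\<^sub>e\<close> is generated by the single pair
  \<open>(\<rho>(e,0), \<rho>(e,1))\<close>, or is the identity if one of the two values diverges.
\<close>

subsection \<open>Total recursive functions\<close>

definition total_recursive :: "nat \<Rightarrow> (nat list \<Rightarrow> nat) \<Rightarrow> bool" where
  "total_recursive n F \<longleftrightarrow> (\<exists>p. \<forall>xs. length xs = n \<longrightarrow> rec_eval p xs = Some (F xs))"

definition total_recursive_list :: "nat \<Rightarrow> nat \<Rightarrow> (nat list \<Rightarrow> nat list) \<Rightarrow> bool" where
  "total_recursive_list n m V \<longleftrightarrow>
     (\<exists>ps. length ps = m \<and>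
       (\<forall>xs. length xs = n \<longrightarrow> map (\<lambda>p. rec_eval p xs) ps = map Some (V xs)))"

section \<open>Components of tuples and lists of optional values\<close>

lemma arg_Cons_0 [simp]: "arg (x # xs) 0 = x"
  and arg_Cons_Suc [simp]: "arg (x # xs) (Suc i) = arg xs i"
  by (simp_all add: arg_def)

lemma arg_Cons_numeral [simp]: "arg (x # xs) (numeral k) = arg xs (pred_numeral k)"
  by (simp add: numeral_eq_Suc)

lemma arg_drop: "arg (drop k xs) i = arg xs (k + i)"
  by (auto simp: arg_def)

lemma those_map_Some [simp]: "those (map Some xs) = Some xs"
  by (induction xs) auto

lemma those_eq_Some_iff: "those ys = Some xs \<longleftrightarrow> ys = map Some xs"
  by (induction ys arbitrary: xs) (auto split: option.splits)

lemma total_recursive_cong: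
  assumes "total_recursive n F" "\<And>xs. length xs = n \<Longrightarrow> F xs = G xs"
  shows "total_recursive n G"
  using assms unfolding total_recursive_def by metis

lemma total_recursive_list_cong:
  assumes "total_recursive_list n m V" "\<And>xs. length xs = n \<Longrightarrow> V xs = U xs"
  shows "total_recursive_list n m U"
  using assms unfolding total_recursive_list_def by metis

text \<open>The collected rules follow the syntax of a function, so that an explicit expression is
  shown recursive by repeated introduction, without writing down its term.\<close>

named_theorems recursive_intros

lemma total_recursive_list_Nil [recursive_intros]: "total_recursive_list n 0 (\<lambda>xs. [])"
  by (simp add: total_recursive_list_def)

lemma total_recursive_list_Cons [recursive_intros]:
  assumes "total_recursive n F" "total_recursive_list n m V"
  shows "total_recursive_list n (Suc m) (\<lambda>xs. F xs # V xs)"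
proof -
  obtain p ps where "\<forall>xs. length xs = n \<longrightarrow> rec_eval p xs = Some (F xs)" "length ps = m"
    "\<forall>xs. length xs = n \<longrightarrow> map (\<lambda>p. rec_eval p xs) ps = map Some (V xs)"
    using assms unfolding total_recursive_def total_recursive_list_def by blast
  then show ?thesis
    unfolding total_recursive_list_def by (intro exI[of _ "p # ps"]) auto
qed

lemma total_recursive_list_map [recursive_intros]:
  assumes "\<And>a. a \<in> set as \<Longrightarrow> total_recursive n (F a)"
  shows "total_recursive_list n (length as) (\<lambda>xs. map (\<lambda>a. F a xs) as)"
  using assms by (induction as) (auto intro: recursive_intros)

lemma total_recursive_arg [recursive_intros]: "total_recursive n (\<lambda>xs. arg xs i)"
  unfolding total_recursive_def by (rule exI[of _ "Proj i"]) simp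

text \<open>At a fixed length \<open>n\<close> the dropped tuple is a list of projections with
  indices in \<open>[k..<n]\<close>; this is one reason for fixing lengths although terms have no
  arity.\<close>

lemma total_recursive_list_drop [recursive_intros]:
  "total_recursive_list n (n - k) (\<lambda>xs. drop k xs)"
proof -
  have "total_recursive_list n (length [k..<n]) (\<lambda>xs. map (\<lambda>i. arg xs i) [k..<n])"
    by (intro recursive_intros)
  then have "total_recursive_list n (n - k) (\<lambda>xs. map (\<lambda>i. arg xs i) [k..<n])"
    by simp
  then show ?thesis
    by (rule total_recursive_list_cong) (auto simp: arg_def intro!: nth_equalityI)
qed

lemma total_recursive_list_id [recursive_intros]: "total_recursive_list n n (\<lambda>xs. xs)"
  using total_recursive_list_drop[of n 0] by simp

lemma total_recursive_comp:
  assumes "total_recursive m F" "total_recursive_list n m V"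
  shows "total_recursive n (\<lambda>xs. F (V xs))"
proof -
  obtain p ps where p: "\<forall>xs. length xs = m \<longrightarrow> rec_eval p xs = Some (F xs)" and
    ps: "length ps = m" "\<forall>xs. length xs = n \<longrightarrow> map (\<lambda>p. rec_eval p xs) ps = map Some (V xs)"
    using assms unfolding total_recursive_def total_recursive_list_def by blast
  have "length (V xs) = m" if "length xs = n" for xs
    using ps that by (metis length_map)
  with p ps show ?thesis
    unfolding total_recursive_def
    by (intro exI[of _ "Comp p ps"]) (simp add: comp_def)
qed

lemma total_recursive_Suc [recursive_intros]:
  assumes "total_recursive n F"
  shows "total_recursive n (\<lambda>xs. Suc (F xs))"
proof -
  have "total_recursive 1 (\<lambda>xs. Suc (arg xs 0))"
    unfolding total_recursive_def by (rule exI[of _ Succ]) simp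
  moreover have "total_recursive_list n 1 (\<lambda>xs. [F xs])"
    unfolding One_nat_def by (intro recursive_intros assms)
  ultimately have "total_recursive n (\<lambda>xs. Suc (arg [F xs] 0))"
    by (rule total_recursive_comp)
  then show ?thesis
    by simp
qed

lemma total_recursive_const [recursive_intros]: "total_recursive n (\<lambda>xs. c)"
proof (induction c)
  case 0
  show ?case
    unfolding total_recursive_def by (rule exI[of _ Zero]) simp
qed (rule total_recursive_Suc)

text \<open>\<open>PrimRec\<close> recurses on the first component and keeps the tail as parameters.
  Prepending the depth \<open>B xs\<close> to the whole tuple makes this tail \<open>xs\<close>
  itself.\<close>

lemma total_recursive_rec_nat [recursive_intros]:
  assumes "total_recursive n B" "total_recursive n F"
    and "total_recursive (Suc (Suc n)) (\<lambda>xs. G (arg xs 0) (arg xs 1) (drop 2 xs))"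
  shows "total_recursive n (\<lambda>xs. rec_nat (F xs) (\<lambda>i r. G i r xs) (B xs))"
proof -
  obtain f g where f: "\<forall>xs. length xs = n \<longrightarrow> rec_eval f xs = Some (F xs)"
    and g: "\<forall>xs. length xs = Suc (Suc n) \<longrightarrow>
      rec_eval g xs = Some (G (arg xs 0) (arg xs 1) (drop 2 xs))"
    using assms unfolding total_recursive_def by blast
  have rec: "rec_nat (rec_eval f ys) (\<lambda>i r. Option.bind r (\<lambda>v. rec_eval g (i # v # ys))) x =
      Some (rec_nat (F ys) (\<lambda>i r. G i r ys) x)" if "length ys = n" for x ys
    using that f g by (induction x) simp_all
  have "total_recursive (Suc n) (\<lambda>xs. rec_nat (F (tl xs)) (\<lambda>i r. G i r (tl xs)) (arg xs 0))"
    unfolding total_recursive_def using rec by (intro exI[of _ "PrimRec f g"]) simp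
  from total_recursive_comp[OF this total_recursive_list_Cons[OF assms(1) total_recursive_list_id]]
  show ?thesis
    by simp
qed

lemma total_recursive_if_zero [recursive_intros]:
  assumes "total_recursive n C" "total_recursive n F" "total_recursive n G"
  shows "total_recursive n (\<lambda>xs. if C xs = 0 then F xs else G xs)"
proof -
  have "total_recursive n (\<lambda>xs. rec_nat (F xs) (\<lambda>i r. G xs) (C xs))"
    by (intro recursive_intros assms total_recursive_comp[OF assms(3)])
       (use total_recursive_list_drop[of "Suc (Suc n)" 2] in simp)
  moreover have "rec_nat (F xs) (\<lambda>i r. G xs) (C xs) = (if C xs = 0 then F xs else G xs)" for xs
    by (cases "C xs") auto
  ultimately show ?thesis
    by simp
qed

lemma total_recursive_lift2:
  assumes "total_recursive 2 (\<lambda>xs. h (arg xs 0) (arg xs 1))"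
    and "total_recursive n F" "total_recursive n G"
  shows "total_recursive n (\<lambda>xs. h (F xs) (G xs))"
proof -
  have "total_recursive_list n 2 (\<lambda>xs. [F xs, G xs])"
    unfolding numeral_2_eq_2 by (intro recursive_intros assms)
  from total_recursive_comp[OF assms(1) this] show ?thesis
    by simp
qed

section \<open>Arithmetic, bounded sums, total search and pairing\<close>

lemma total_recursive_add [recursive_intros]:
  assumes "total_recursive n F" "total_recursive n G"
  shows "total_recursive n (\<lambda>xs. F xs + G xs)"
proof (rule total_recursive_lift2[OF _ assms])
  have "rec_nat a (\<lambda>i. Suc) b = a + b" for a b :: nat
    by (induction b) auto
  moreover have "total_recursive 2 (\<lambda>xs. rec_nat (arg xs 0) (\<lambda>i. Suc) (arg xs 1))"
    by (intro recursive_intros)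
  ultimately show "total_recursive 2 (\<lambda>xs. arg xs 0 + arg xs 1)"
    by simp
qed

lemma total_recursive_mult [recursive_intros]:
  assumes "total_recursive n F" "total_recursive n G"
  shows "total_recursive n (\<lambda>xs. F xs * G xs)"
proof (rule total_recursive_lift2[OF _ assms])
  have "rec_nat 0 (\<lambda>i r. r + a) b = a * b" for a b :: nat
    by (induction b) auto
  moreover have "total_recursive 2 (\<lambda>xs. rec_nat 0 (\<lambda>i r. r + arg xs 0) (arg xs 1))"
    unfolding arg_drop by (intro recursive_intros, simp add: arg_drop, intro recursive_intros)
  ultimately show "total_recursive 2 (\<lambda>xs. arg xs 0 * arg xs 1)"
    by simp
qed

lemma total_recursive_diff [recursive_intros]:
  assumes "total_recursive n F" "total_recursive n G"
  shows "total_recursive n (\<lambda>xs. F xs - G xs)"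
proof (rule total_recursive_lift2[OF _ assms])
  \<comment> \<open>The predecessor is a recursion that returns its last index; truncated
    subtraction iterates it.\<close>
  have pred: "rec_nat 0 (\<lambda>i r. i) b = b - 1" for b :: nat
    by (cases b) auto
  have sub: "rec_nat a (\<lambda>i r. rec_nat 0 (\<lambda>i r. i) r) b = a - b" for a b :: nat
    by (induction b) (auto simp: pred)
  have "total_recursive 2 (\<lambda>xs. rec_nat (arg xs 0) (\<lambda>i r. rec_nat 0 (\<lambda>i r. i) r) (arg xs 1))"
    by (intro recursive_intros)
  then show "total_recursive 2 (\<lambda>xs. arg xs 0 - arg xs 1)"
    by (simp only: sub)
qed

lemma total_recursive_sum [recursive_intros]:
  assumes "total_recursive n B" "total_recursive (Suc n) (\<lambda>xs. F (arg xs 0) (drop 1 xs))"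
  shows "total_recursive n (\<lambda>xs. \<Sum>i<B xs. F i xs)"
proof -
  have "total_recursive (Suc (Suc n)) (\<lambda>xs. F (arg xs 0) (drop 2 xs))"
  proof (rule total_recursive_cong)
    show "total_recursive (Suc (Suc n))
        (\<lambda>xs. (\<lambda>xs. F (arg xs 0) (drop 1 xs)) (arg xs 0 # drop 2 xs))"
      using total_recursive_list_drop[of "Suc (Suc n)" 2]
      by (intro total_recursive_comp[OF assms(2)] recursive_intros) simp
  qed simp
  then have "total_recursive n (\<lambda>xs. rec_nat 0 (\<lambda>i r. r + F i xs) (B xs))"
    by (intro recursive_intros assms)
  moreover have "rec_nat 0 (\<lambda>i r. r + F i xs) b = (\<Sum>i<b. F i xs)" for b xs
    by (induction b) auto
  ultimately show ?thesis
    by simp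
qed

text \<open>As \<open>F\<close> is total, the convergence that \<open>Mu\<close> demands below the
  least zero is automatic, and the second premise makes the search end.\<close>

lemma total_recursive_Least [recursive_intros]:
  assumes "total_recursive (Suc n) (\<lambda>xs. F (arg xs 0) (drop 1 xs))"
    and "\<And>xs. length xs = n \<Longrightarrow> \<exists>i. F i xs = 0"
  shows "total_recursive n (\<lambda>xs. LEAST i. F i xs = 0)"
proof -
  obtain p where "\<forall>xs. length xs = Suc n \<longrightarrow> rec_eval p xs = Some (F (arg xs 0) (drop 1 xs))"
    using assms(1) unfolding total_recursive_def by blast
  then show ?thesis
    unfolding total_recursive_def using assms(2)
    by (intro exI[of _ "Mu p"]) (simp add: Let_def)
qed

lemma total_recursive_prod_encode [recursive_intros]:
  assumes "total_recursive n F" "total_recursive n G"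
  shows "total_recursive n (\<lambda>xs. prod_encode (F xs, G xs))"
proof (rule total_recursive_lift2[OF _ assms])
  \<comment> \<open>Cantor pairing adds the first component to a triangular number, which is a
    bounded sum.\<close>
  have "triangle m = (\<Sum>i<m. Suc i)" for m
    by (induction m) auto
  moreover have "total_recursive 2
      (\<lambda>xs. (\<Sum>i<arg xs 0 + arg xs 1. Suc i) + arg xs 0)"
    by (intro recursive_intros)
  ultimately show "total_recursive 2 (\<lambda>xs. prod_encode (arg xs 0, arg xs 1))"
    by (simp add: prod_encode_def)
qed

lemma total_recursive_of_bool_less [recursive_intros]:
  assumes "total_recursive n F" "total_recursive n G"
  shows "total_recursive n (\<lambda>xs. of_bool (F xs < G xs))"
proof -
  have "total_recursive n (\<lambda>xs. if G xs - F xs = 0 then 0 else 1)"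
    by (intro recursive_intros assms)
  then show ?thesis
    by (rule total_recursive_cong) simp
qed

lemma total_recursive_lift1:
  assumes "total_recursive 1 (\<lambda>xs. h (arg xs 0))" "total_recursive n F"
  shows "total_recursive n (\<lambda>xs. h (F xs))"
proof -
  have "total_recursive_list n 1 (\<lambda>xs. [F xs])"
    unfolding One_nat_def by (intro recursive_intros assms)
  from total_recursive_comp[OF assms(1) this] show ?thesis
    by simp
qed

text \<open>Shaped for stage functions \<open>S t xs\<close>, whose stage is the first component of
  the tuple.\<close>

lemma total_recursive_comp_Cons:
  assumes "total_recursive (Suc m) (\<lambda>xs. F (arg xs 0) (drop 1 xs))"
    and "total_recursive n T" "total_recursive_list n m V"
  shows "total_recursive n (\<lambda>xs. F (T xs) (V xs))"
  using total_recursive_comp[OF assms(1) total_recursive_list_Cons[OF assms(2,3)]] by simp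

lemma total_recursive_prod_list:
  assumes "\<And>a. a \<in> set as \<Longrightarrow> total_recursive n (F a)"
  shows "total_recursive n (\<lambda>xs. prod_list (map (\<lambda>a. F a xs) as))"
  using assms
proof (induction as)
  case (Cons a as)
  then have "total_recursive n (\<lambda>xs. F a xs * prod_list (map (\<lambda>a. F a xs) as))"
    by (intro recursive_intros) auto
  then show ?case
    by simp
qed (simp add: recursive_intros)

subsection \<open>Stagewise approximation of partial recursive functions\<close>

text \<open>
  \<open>S t xs\<close> is \<open>0\<close> if no value is known at stage \<open>t\<close>, and \<open>Suc v\<close> if \<open>v\<close> is. Asking that the value
  is known at almost all stages replaces monotonicity in \<open>t\<close>.
\<close>

definition stage_approximation :: "nat \<Rightarrow> recf \<Rightarrow> (nat \<Rightarrow> nat list \<Rightarrow> nat) \<Rightarrow> bool" where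
  "stage_approximation n p S \<longleftrightarrow>
     total_recursive (Suc n) (\<lambda>xs. S (arg xs 0) (drop 1 xs)) \<and>
     (\<forall>xs. length xs = n \<longrightarrow>
       (\<forall>t v. S t xs = Suc v \<longrightarrow> rec_eval p xs = Some v) \<and>
       (\<forall>v. rec_eval p xs = Some v \<longrightarrow> (\<forall>\<^sub>F t in sequentially. S t xs = Suc v)))"

lemma stage_approximationI:
  assumes "total_recursive (Suc n) (\<lambda>xs. S (arg xs 0) (drop 1 xs))"
    and "\<And>xs t v. length xs = n \<Longrightarrow> S t xs = Suc v \<Longrightarrow> rec_eval p xs = Some v"
    and "\<And>xs v. length xs = n \<Longrightarrow> rec_eval p xs = Some v \<Longrightarrow>
      \<forall>\<^sub>F t in sequentially. S t xs = Suc v"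
  shows "stage_approximation n p S"
  using assms unfolding stage_approximation_def by blast

lemma stage_approximationD:
  assumes "stage_approximation n p S"
  shows stage_recursive: "total_recursive (Suc n) (\<lambda>xs. S (arg xs 0) (drop 1 xs))"
    and stage_sound: "length xs = n \<Longrightarrow> S t xs = Suc v \<Longrightarrow> rec_eval p xs = Some v"
    and stage_complete: "length xs = n \<Longrightarrow> rec_eval p xs = Some v \<Longrightarrow>
      \<forall>\<^sub>F t in sequentially. S t xs = Suc v"
  using assms unfolding stage_approximation_def by blast+

lemma rec_eval_Comp:
  "rec_eval (Comp f gs) xs = Option.bind (those (map (\<lambda>g. rec_eval g xs) gs)) (rec_eval f)"
  by (simp add: comp_def)

text \<open>The product is nonzero exactly when all inner values are known, and subtracting 1 then
  decodes them. As \<open>gs\<close> is finite, almost all stages know all inner values at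
  once.\<close>

lemma stage_approximation_Comp:
  assumes f: "stage_approximation (length gs) f S"
    and g: "\<And>g. g \<in> set gs \<Longrightarrow> stage_approximation n g (U g)"
  shows "stage_approximation n (Comp f gs)
    (\<lambda>t xs. if prod_list (map (\<lambda>g. U g t xs) gs) = 0 then 0
            else S t (map (\<lambda>g. U g t xs - 1) gs))"
proof (rule stage_approximationI)
  have "total_recursive (Suc n) (\<lambda>xs. U g (arg xs 0) (drop 1 xs))" if "g \<in> set gs" for g
    using stage_recursive[OF g[OF that]] .
  then show "total_recursive (Suc n)
     (\<lambda>xs. if prod_list (map (\<lambda>g. U g (arg xs 0) (drop 1 xs)) gs) = 0 then 0
       else S (arg xs 0) (map (\<lambda>g. U g (arg xs 0) (drop 1 xs) - 1) gs))"
    by (intro recursive_intros total_recursive_prod_list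
        total_recursive_comp_Cons[OF stage_recursive[OF f]])
next
  fix xs t v
  assume xs: "length xs = n"
    and eq: "(if prod_list (map (\<lambda>g. U g t xs) gs) = 0 then 0
      else S t (map (\<lambda>g. U g t xs - 1) gs)) = Suc v"
  then have nz: "prod_list (map (\<lambda>g. U g t xs) gs) \<noteq> 0"
    and v: "S t (map (\<lambda>g. U g t xs - 1) gs) = Suc v"
    by (auto split: if_splits)
  have "rec_eval g xs = Some (U g t xs - 1)" if "g \<in> set gs" for g
  proof -
    have "U g t xs \<noteq> 0"
      using nz that by (auto simp: prod_list_zero_iff image_iff)
    then show ?thesis
      using stage_sound[OF g[OF that] xs] by (metis Suc_pred' neq0_conv)
  qed
  then have "map (\<lambda>g. rec_eval g xs) gs = map Some (map (\<lambda>g. U g t xs - 1) gs)"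
    by simp
  moreover have "rec_eval f (map (\<lambda>g. U g t xs - 1) gs) = Some v"
    using stage_sound[OF f _ v] by simp
  ultimately show "rec_eval (Comp f gs) xs = Some v"
    by (simp only: rec_eval_Comp those_map_Some bind.bind_lunit)
next
  fix xs v
  assume xs: "length xs = n" and eq: "rec_eval (Comp f gs) xs = Some v"
  from eq obtain ys where ys: "map (\<lambda>g. rec_eval g xs) gs = map Some ys"
    and v: "rec_eval f ys = Some v"
    by (auto simp: bind_eq_Some_conv those_eq_Some_iff comp_def)
  have len: "length ys = length gs"
    using ys by (metis length_map)
  have U: "\<forall>\<^sub>F t in sequentially. U (gs ! i) t xs = Suc (ys ! i)" if "i < length gs" for i
  proof (rule stage_complete[OF g xs])
    show "rec_eval (gs ! i) xs = Some (ys ! i)"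
      using arg_cong[OF ys, of "\<lambda>zs. zs ! i"] that len by simp
  qed (use that in simp)
  have "\<forall>\<^sub>F t in sequentially. \<forall>i\<in>{..<length gs}. U (gs ! i) t xs = Suc (ys ! i)"
    by (rule eventually_ball_finite) (use U in auto)
  moreover have "\<forall>\<^sub>F t in sequentially. S t ys = Suc v"
    by (rule stage_complete[OF f len v])
  ultimately show "\<forall>\<^sub>F t in sequentially. (if prod_list (map (\<lambda>g. U g t xs) gs) = 0 then 0
      else S t (map (\<lambda>g. U g t xs - 1) gs)) = Suc v"
  proof eventually_elim
    case (elim t)
    then have "map (\<lambda>g. U g t xs - 1) gs = ys"
      using len by (auto intro!: nth_equalityI)
    moreover have "0 \<notin> set (map (\<lambda>g. U g t xs) gs)"
      using elim(1) by (auto simp: in_set_conv_nth)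
    ultimately show ?case
      using elim(2) by (simp add: prod_list_zero_iff)
  qed
qed

text \<open>An unknown value, 0, propagates through the recursion. The parameter length
  \<open>n - 1\<close> is right for the empty tuple too: its tail is empty and its missing first
  component is read as 0.\<close>

lemma stage_approximation_PrimRec:
  assumes f: "stage_approximation (n - 1) f S"
    and g: "stage_approximation (Suc (Suc (n - 1))) g U"
  shows "stage_approximation n (PrimRec f g)
    (\<lambda>t xs. rec_nat (S t (drop 1 xs))
       (\<lambda>i r. if r = 0 then 0 else U t (i # (r - 1) # drop 1 xs)) (arg xs 0))"
    (is "stage_approximation _ _ (\<lambda>t xs. ?r t xs (arg xs 0))")
proof (rule stage_approximationI)
  \<comment> \<open>The parameters stand behind stage and depth in the base case, and behind index,
    previous value, stage and depth in the step.\<close>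
  have "total_recursive_list (Suc n) (n - 1) (\<lambda>xs. drop 2 xs)"
    and "total_recursive_list (Suc (Suc (Suc n))) (n - 1) (\<lambda>xs. drop 4 xs)"
    using total_recursive_list_drop[of "Suc n" 2]
      total_recursive_list_drop[of "Suc (Suc (Suc n))" 4] by (simp_all add: eval_nat_numeral)
  note drops = this
  have base: "total_recursive (Suc n) (\<lambda>xs. S (arg xs 0) (drop 2 xs))"
    by (intro recursive_intros total_recursive_comp_Cons[OF stage_recursive[OF f]] drops)
  have step: "total_recursive (Suc (Suc (Suc n))) (\<lambda>xs. if arg xs 1 = 0 then 0
       else U (arg xs 2) (arg xs 0 # (arg xs 1 - 1) # drop 4 xs))"
    by (intro recursive_intros total_recursive_comp_Cons[OF stage_recursive[OF g]] drops)
  have "total_recursive (Suc n) (\<lambda>xs. rec_nat (S (arg xs 0) (drop 2 xs))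
      (\<lambda>i r. if r = 0 then 0 else U (arg xs 0) (i # (r - 1) # drop 2 xs)) (arg xs 1))"
    by (intro total_recursive_rec_nat base total_recursive_arg)
      (rule total_recursive_cong[OF step], simp add: arg_drop)
  then show "total_recursive (Suc n) (\<lambda>xs. ?r (arg xs 0) (drop 1 xs) (arg (drop 1 xs) 0))"
    by (simp add: arg_drop numeral_2_eq_2 cong: if_cong)
next
  fix xs t v
  assume xs: "length xs = n" and eq: "?r t xs (arg xs 0) = Suc v"
  have "rec_nat (rec_eval f (tl xs))
      (\<lambda>i r. Option.bind r (\<lambda>v. rec_eval g (i # v # tl xs))) x = Some v"
    if "?r t xs x = Suc v" for x v
    using that
  proof (induction x arbitrary: v)
    case 0
    then show ?case
      using stage_sound[OF f, of "tl xs" t v] xs by (simp add: drop_Suc)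
  next
    case (Suc x)
    then obtain u where u: "?r t xs x = Suc u"
      by (cases "?r t xs x") auto
    with Suc.prems have "U t (x # u # tl xs) = Suc v"
      by (simp add: drop_Suc)
    then have "rec_eval g (x # u # tl xs) = Some v"
      using stage_sound[OF g, of "x # u # tl xs"] xs by simp
    then show ?case
      using Suc.IH[OF u] by simp
  qed
  then show "rec_eval (PrimRec f g) xs = Some v"
    using eq by simp
next
  fix xs v
  assume xs: "length xs = n" and eq: "rec_eval (PrimRec f g) xs = Some v"
  have "\<forall>\<^sub>F t in sequentially. ?r t xs x = Suc v"
    if "rec_nat (rec_eval f (tl xs))
      (\<lambda>i r. Option.bind r (\<lambda>v. rec_eval g (i # v # tl xs))) x = Some v" for x v
    using that
  proof (induction x arbitrary: v)
    case 0
    then show ?case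
      using stage_complete[OF f, of "tl xs" v] xs by (simp add: drop_Suc)
  next
    case (Suc x)
    then obtain u where u: "rec_nat (rec_eval f (tl xs))
        (\<lambda>i r. Option.bind r (\<lambda>v. rec_eval g (i # v # tl xs))) x = Some u"
      and v: "rec_eval g (x # u # tl xs) = Some v"
      by (auto simp: bind_eq_Some_conv)
    have "\<forall>\<^sub>F t in sequentially. U t (x # u # tl xs) = Suc v"
      using stage_complete[OF g _ v] xs by simp
    with Suc.IH[OF u] show ?case
      by eventually_elim (simp add: drop_Suc)
  qed
  then show "\<forall>\<^sub>F t in sequentially. ?r t xs (arg xs 0) = Suc v"
    using eq by simp
qed

text \<open>
  The factor \<open>t - i\<close> makes the search total, and the truncated \<open>S t (i # xs) - 1\<close> vanishes both
  where \<open>f\<close> is not yet known to converge and where its value is \<open>0\<close>.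
\<close>

lemma stage_approximation_Mu:
  assumes f: "stage_approximation (Suc n) f S"
  defines "N \<equiv> \<lambda>t xs. LEAST i. (t - i) * (S t (i # xs) - 1) = 0"
  shows "stage_approximation n (Mu f)
    (\<lambda>t xs. if S t (N t xs # xs) = 0 then 0
            else if S t (N t xs # xs) - 1 = 0 then Suc (N t xs) else 0)"
proof (rule stage_approximationI)
  have step: "total_recursive (Suc (Suc n)) (\<lambda>xs. (arg xs 1 - arg xs 0) *
      (S (arg xs 1) (arg xs 0 # drop 2 xs) - 1))"
    using total_recursive_list_drop[of "Suc (Suc n)" 2]
    by (intro recursive_intros total_recursive_comp_Cons[OF stage_recursive[OF f]]) simp
  have N: "total_recursive (Suc n) (\<lambda>xs. N (arg xs 0) (drop 1 xs))"
    unfolding N_def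
  proof (rule total_recursive_Least)
    show "total_recursive (Suc (Suc n)) (\<lambda>xs. (arg (drop 1 xs) 0 - arg xs 0) *
        (S (arg (drop 1 xs) 0) (arg xs 0 # drop 1 (drop 1 xs)) - 1))"
      by (rule total_recursive_cong[OF step]) (simp add: arg_drop numeral_2_eq_2)
    show "\<exists>i. (arg xs 0 - i) * (S (arg xs 0) (i # drop 1 xs) - 1) = 0" for xs
      by (rule exI[of _ "arg xs 0"]) simp
  qed
  have d: "total_recursive_list (Suc n) n (\<lambda>xs. drop 1 xs)"
    using total_recursive_list_drop[of "Suc n" 1] by simp
  show "total_recursive (Suc n)
     (\<lambda>xs. if S (arg xs 0) (N (arg xs 0) (drop 1 xs) # drop 1 xs) = 0 then 0
       else if S (arg xs 0) (N (arg xs 0) (drop 1 xs) # drop 1 xs) - 1 = 0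
            then Suc (N (arg xs 0) (drop 1 xs)) else 0)"
    by (intro recursive_intros total_recursive_comp_Cons[OF stage_recursive[OF f]] N d)
next
  fix xs t v
  assume xs: "length xs = n"
    and "(if S t (N t xs # xs) = 0 then 0
          else if S t (N t xs # xs) - 1 = 0 then Suc (N t xs) else 0) = Suc v"
  \<comment> \<open>The search may also stop at an unknown value or at the cut-off; only a known
    zero of \<open>f\<close> gives a nonzero result.\<close>
  then have v: "N t xs = v" and one: "S t (v # xs) = Suc 0"
    by (auto split: if_splits)
  have zero: "rec_eval f (v # xs) = Some 0"
    using stage_sound[OF f _ one] xs by simp
  \<comment> \<open>By minimality the product is nonzero at \<open>i\<close>, so
    \<open>S t (i # xs)\<close> is at least 2 and encodes a positive value.\<close>
  have pos: "\<exists>w. rec_eval f (i # xs) = Some (Suc w)" if "i < v" for i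
  proof -
    have "(t - i) * (S t (i # xs) - 1) \<noteq> 0"
      using not_less_Least[of i "\<lambda>i. (t - i) * (S t (i # xs) - 1) = 0"] that v
      unfolding N_def by blast
    then obtain w where "S t (i # xs) = Suc (Suc w)"
      by (cases "S t (i # xs)"; cases "S t (i # xs) - 1") auto
    then show ?thesis
      using stage_sound[OF f, of "i # xs" t "Suc w"] xs by auto
  qed
  let ?P = "\<lambda>n. rec_eval f (n # xs) = Some 0 \<and> (\<forall>i<n. rec_eval f (i # xs) \<noteq> None)"
  have P: "?P v"
    using zero pos by fastforce
  moreover have "(LEAST n. ?P n) = v"
    by (rule Least_equality) (use P pos in \<open>force simp: not_less[symmetric]\<close>)+
  ultimately show "rec_eval (Mu f) xs = Some v"
    by (auto simp: Let_def)
next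
  fix xs v
  assume xs: "length xs = n" and eq: "rec_eval (Mu f) xs = Some v"
  let ?P = "\<lambda>n. rec_eval f (n # xs) = Some 0 \<and> (\<forall>i<n. rec_eval f (i # xs) \<noteq> None)"
  have ex: "\<exists>n. ?P n" and v: "v = (LEAST n. ?P n)"
    using eq by (auto simp: Let_def split: if_splits)
  have P: "?P v"
    unfolding v by (rule LeastI_ex[OF ex])
  have "\<exists>w. rec_eval f (i # xs) = Some (Suc w)" if i: "i < v" for i
  proof -
    obtain w where w: "rec_eval f (i # xs) = Some w"
      using P i by blast
    have "\<not> ?P i"
      using not_less_Least[of i ?P] i v by blast
    moreover have "\<forall>j<i. rec_eval f (j # xs) \<noteq> None"
      using P i by auto
    ultimately have "w \<noteq> 0"
      using w by auto
    with w show ?thesis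
      by (metis not0_implies_Suc)
  qed
  then obtain w where w: "\<And>i. i < v \<Longrightarrow> rec_eval f (i # xs) = Some (Suc (w i))"
    by metis
  have "\<forall>\<^sub>F t in sequentially. \<forall>i\<in>{..<v}. S t (i # xs) = Suc (Suc (w i))"
    by (rule eventually_ball_finite) (use stage_complete[OF f _ w] xs in auto)
  moreover have "\<forall>\<^sub>F t in sequentially. S t (v # xs) = Suc 0"
    using stage_complete[OF f] P xs by simp
  \<comment> \<open>From stage \<open>v\<close> on, the cut-off at \<open>t\<close> cannot end the
    search before \<open>v\<close>.\<close>
  moreover have "\<forall>\<^sub>F t in sequentially. v \<le> t"
    by (rule eventually_ge_at_top)
  ultimately show "\<forall>\<^sub>F t in sequentially. (if S t (N t xs # xs) = 0 then 0
      else if S t (N t xs # xs) - 1 = 0 then Suc (N t xs) else 0) = Suc v"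
  proof eventually_elim
    case (elim t)
    have "N t xs = v"
      unfolding N_def
    proof (rule Least_equality)
      show "v \<le> i" if "(t - i) * (S t (i # xs) - 1) = 0" for i
        using that elim by (cases "i < v") auto
    qed (use elim in simp)
    then show ?case
      using elim by simp
  qed
qed

text \<open>Structural induction with \<open>n\<close> arbitrary, because subterms are evaluated at
  other lengths: the outer term of \<open>Comp f gs\<close> at \<open>length gs\<close>, the body of
  \<open>Mu\<close> at one more.\<close>

lemma ex_stage_approximation: "\<exists>S. stage_approximation n p S"
proof (induction p arbitrary: n)
  case Zero
  have "stage_approximation n Zero (\<lambda>t xs. Suc 0)"
    by (rule stage_approximationI) (auto intro: recursive_intros)
  then show ?case by blast
next
  case Succ
  have "stage_approximation n Succ (\<lambda>t xs. Suc (Suc (arg xs 0)))"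
    by (rule stage_approximationI) (auto simp: arg_drop intro!: recursive_intros)
  then show ?case by blast
next
  case (Proj i)
  have "stage_approximation n (Proj i) (\<lambda>t xs. Suc (arg xs i))"
    by (rule stage_approximationI) (auto simp: arg_drop intro!: recursive_intros)
  then show ?case by blast
next
  case (Comp f gs)
  obtain S where "stage_approximation (length gs) f S"
    using Comp.IH(1) by blast
  moreover have "\<forall>g\<in>set gs. \<exists>U. stage_approximation n g U"
    using Comp.IH(2) by blast
  then obtain U where "\<And>g. g \<in> set gs \<Longrightarrow> stage_approximation n g (U g)"
    by (metis bchoice)
  ultimately show ?case
    using stage_approximation_Comp by blast
next
  case (PrimRec f g)
  then show ?case
    using stage_approximation_PrimRec by blast
next
  case (Mu f)
  then show ?case
    using stage_approximation_Mu by blast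
qed

subsection \<open>The recursion theorem\<close>

text \<open>Terms for numerals, by which a code can be hard-wired into a term.\<close>

primrec const_recf :: "nat \<Rightarrow> recf" where
  "const_recf 0 = Zero"
| "const_recf (Suc c) = Comp Succ [const_recf c]"

lemma rec_eval_const_recf [simp]: "rec_eval (const_recf c) xs = Some c"
  by (induction c) auto

lemma total_recursive_code_const_recf:
  assumes "total_recursive n F"
  shows "total_recursive n (\<lambda>xs. code (const_recf (F xs)))"
proof -
  \<comment> \<open>\<open>Suc (prod_encode (r, 0))\<close> is \<open>list_encode [r]\<close>, so
    each step turns the code \<open>r\<close> of a term into the code of \<open>Comp Succ\<close>
    over it.\<close>
  have "code (const_recf c) = rec_nat (code Zero)
      (\<lambda>_ r. prod_encode (3, prod_encode (code Succ, Suc (prod_encode (r, 0))))) c" for c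
    by (induction c) auto
  moreover have "total_recursive n (\<lambda>xs. rec_nat (code Zero)
      (\<lambda>_ r. prod_encode (3, prod_encode (code Succ, Suc (prod_encode (r, 0))))) (F xs))"
    by (intro recursive_intros assms)
  ultimately show ?thesis
    by simp
qed

lemma phi_code [simp]: "phi (code p) x = rec_eval p [x]"
  by (simp add: phi_def inj_code)

text \<open>Diagonalisation: \<open>?s\<close> sends the code \<open>y\<close> of a term to the code
  of that term with \<open>y\<close> hard-wired as first argument. As \<open>q\<close> runs
  \<open>p\<close> on \<open>?s y\<close>, hard-wiring \<open>code q\<close> into \<open>q\<close>
  gives an index \<open>e\<close> that \<open>p\<close> receives as input.\<close>

lemma kleene_recursion: "\<exists>e. \<forall>x. phi e x = rec_eval p [e, x]"
proof -
  let ?s = "\<lambda>y. prod_encode (3, prod_encode (y,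
    Suc (prod_encode (code (const_recf y), list_encode [code (Proj 0)]))))"
  \<comment> \<open>Length 2 with the second component ignored, since \<open>q\<close> evaluates
    \<open>s\<close> on \<open>[y, x]\<close>.\<close>
  have "total_recursive 2 (\<lambda>xs. ?s (arg xs 0))"
    by (intro recursive_intros total_recursive_code_const_recf)
  then obtain s where "\<forall>xs. length xs = 2 \<longrightarrow> rec_eval s xs = Some (?s (arg xs 0))"
    unfolding total_recursive_def by blast
  then have s: "rec_eval s [y, x] = Some (?s y)" for x y
    by (metis arg_Cons_0 length_Cons list.size(3) numeral_2_eq_2)
  define q where "q = Comp p [s, Proj 1]"
  define e where "e = code (Comp q [const_recf (code q), Proj 0])"
  have e: "e = ?s (code q)"
    by (simp add: e_def)
  have "phi e x = rec_eval q [code q, x]" for x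
    by (simp add: e_def del: code.simps)
  also have "rec_eval q [code q, x] = rec_eval p [e, x]" for x
    by (simp add: q_def s e)
  finally show ?thesis
    by blast
qed

subsection \<open>No uniform reduction\<close>

text \<open>Each link of a chain is the pair \<open>(a, b)\<close> in one of its two directions, so
  a nontrivial chain never leaves \<open>{a, b}\<close>.\<close>

lemma equivclp_single_pair:
  assumes "equivclp r x y" and "\<And>x y. r x y \<Longrightarrow> x = a \<and> y = b"
  shows "x = y \<or> x \<in> {a, b} \<and> y \<in> {a, b}"
  using assms(1)
proof (induction rule: equivclp_induct)
  case (step y z)
  then show ?case
    using assms(2)[of y z] assms(2)[of z y] by auto
qed simp

text \<open>Classes have at most two elements. The hypothesis allows an empty \<open>r\<close>,
  which covers diverging values of \<open>\<rho>\<close>.\<close>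

lemma k_bounded_single_pair:
  assumes "\<And>x y. r x y \<Longrightarrow> x = a \<and> y = b" "k > 1"
  shows "k_bounded k (equivclp r)"
  unfolding k_bounded_def
proof
  fix x
  have "{y. equivclp r x y} \<subseteq> (if x \<in> {a, b} then {a, b} else {x})"
    using equivclp_single_pair[OF _ assms(1)] by fastforce
  moreover have "card (if x \<in> {a, b} then {a, b} else {x}) \<le> 2"
    by (auto simp: card_insert_if)
  ultimately show "finite {y. equivclp r x y} \<and> card {y. equivclp r x y} \<le> k"
    using assms(2) card_mono[of "if x \<in> {a, b} then {a, b} else {x}" "{y. equivclp r x y}"]
    by (auto intro: finite_subset split: if_splits)
qed

text \<open>Membership in \<open>W e\<close> is convergence, so equality is tested by a search whose
  body ignores the search variable: it converges iff the distance from \<open>x\<close> to the pair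
  is 0. Strict composition makes it diverge when one of the two values does.\<close>

lemma ex_index_pair_of_values:
  assumes "partial_computable2 \<rho>"
  shows "\<exists>e. \<forall>x. x \<in> W e \<longleftrightarrow> (\<exists>a b. \<rho> e 0 = Some a \<and> \<rho> e 1 = Some b \<and> x = prod_encode (a, b))"
proof -
  obtain r where r: "\<And>e x. rec_eval r [e, x] = \<rho> e x"
    using assms unfolding partial_computable2_def by blast
  \<comment> \<open>The two truncated differences add up to the distance, which is 0 only for equal
    numbers.\<close>
  have "total_recursive 3 (\<lambda>xs. (arg xs 0 - prod_encode (arg xs 1, arg xs 2)) +
      (prod_encode (arg xs 1, arg xs 2) - arg xs 0))"
    by (intro recursive_intros)
  then obtain d where d': "\<forall>xs. length xs = 3 \<longrightarrow> rec_eval d xs =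
      Some ((arg xs 0 - prod_encode (arg xs 1, arg xs 2)) +
        (prod_encode (arg xs 1, arg xs 2) - arg xs 0))"
    unfolding total_recursive_def by blast
  have d: "rec_eval d [x, a, b] = Some ((x - prod_encode (a, b)) + (prod_encode (a, b) - x))"
    for x a b using d'[rule_format, of "[x, a, b]"] by simp
  \<comment> \<open>Under \<open>Mu\<close> the tuple is the search variable, \<open>e\<close>,
    \<open>x\<close>; hence \<open>Proj 1\<close> for \<open>e\<close> and \<open>Proj 2\<close> for
    \<open>x\<close>.\<close>
  obtain e where e: "\<And>x. phi e x = rec_eval (Mu (Comp d
      [Proj 2, Comp r [Proj 1, const_recf 0], Comp r [Proj 1, const_recf 1]])) [e, x]"
    using kleene_recursion by blast
  have "x \<in> W e \<longleftrightarrow> (\<exists>a b. \<rho> e 0 = Some a \<and> \<rho> e 1 = Some b \<and> x = prod_encode (a, b))" for x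
    by (cases "\<rho> e 0"; cases "\<rho> e 1") (auto simp: W_def e r d Let_def)
  then show ?thesis
    by blast
qed

lemma no_uniform_reduction:
  assumes "k > 1" "partial_computable2 \<rho>"
  shows "\<exists>e. k_bounded k (ceer_of e) \<and>
    \<not> ((\<forall>x. \<rho> e x \<noteq> None) \<and> witnesses (\<lambda>x. the (\<rho> e x)) omega (ceer_of e))"
proof -
  obtain e where e: "\<And>x. x \<in> W e \<longleftrightarrow>
      (\<exists>a b. \<rho> e 0 = Some a \<and> \<rho> e 1 = Some b \<and> x = prod_encode (a, b))"
    using ex_index_pair_of_values[OF assms(2)] by blast
  have "k_bounded k (ceer_of e)"
    unfolding ceer_of_def
    \<comment> \<open>If one of the values diverges, \<open>W e\<close> is empty and the unspecified
      \<open>the None\<close> does no harm.\<close>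
    by (rule k_bounded_single_pair[OF _ assms(1), where a = "the (\<rho> e 0)" and b = "the (\<rho> e 1)"])
      (auto simp: e prod_encode_eq)
  moreover have False
    if total: "\<forall>x. \<rho> e x \<noteq> None" and wit: "witnesses (\<lambda>x. the (\<rho> e x)) omega (ceer_of e)"
  proof -
    obtain a b where "\<rho> e 0 = Some a" "\<rho> e 1 = Some b"
      using total by blast
    then have "ceer_of e (the (\<rho> e 0)) (the (\<rho> e 1))"
      unfolding ceer_of_def by (intro r_into_equivclp) (simp add: e)
    then have "(0 :: nat) = 1"
      using wit unfolding witnesses_def by blast
    then show False
      by simp
  qed
  ultimately show ?thesis
    by blast
qed

subsection \<open>Bounded ceers\<close>

text \<open>\<open>D\<close> is a stage approximation of a term whose domain is \<open>R\<close>;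
  known convergence, with whatever value, certifies a pair.\<close>

lemma ceer_stages:
  assumes "ceer R"
  obtains D where "total_recursive 3 (\<lambda>xs. D (arg xs 0) (arg xs 1) (arg xs 2))"
    and "\<And>t x y. D t x y \<noteq> 0 \<Longrightarrow> R x y"
    and "\<And>x y. R x y \<Longrightarrow> \<forall>\<^sub>F t in sequentially. D t x y \<noteq> 0"
proof -
  obtain e where e: "{prod_encode (x, y) | x y. R x y} = W e" and R: "equivp R"
    using assms unfolding ceer_def ce_def by blast
  have We: "prod_encode (x, y) \<in> W e \<longleftrightarrow> R x y" for x y
    unfolding e[symmetric] by (auto simp: prod_encode_eq)
  \<comment> \<open>Reflexivity makes \<open>W e\<close> nonempty, so \<open>e\<close> must be the
    code of a term.\<close>
  have "R 0 0"
    using R by (rule equivp_reflp)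
  then obtain p where p: "e = code p"
    using We[of 0 0] by (auto simp: W_def phi_def split: if_splits)
  obtain S where S: "stage_approximation 1 p S"
    using ex_stage_approximation by blast
  have iff: "R x y \<longleftrightarrow> (\<exists>v. rec_eval p [prod_encode (x, y)] = Some v)" for x y
    using We[of x y] by (simp add: W_def p)
  show thesis
  proof (rule that[of "\<lambda>t x y. S t [prod_encode (x, y)]"])
    have "total_recursive_list 3 1 (\<lambda>xs. [prod_encode (arg xs 1, arg xs 2)])"
      unfolding One_nat_def by (intro recursive_intros)
    then show "total_recursive 3 (\<lambda>xs. S (arg xs 0) [prod_encode (arg xs 1, arg xs 2)])"
      by (intro total_recursive_comp_Cons[OF stage_recursive[OF S]] total_recursive_arg)
    show "R x y" if nz: "S t [prod_encode (x, y)] \<noteq> 0" for t x y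
    proof -
      obtain v where "S t [prod_encode (x, y)] = Suc v"
        using nz not0_implies_Suc by blast
      then show ?thesis
        using stage_sound[OF S, of "[prod_encode (x, y)]" t v] iff by simp
    qed
    show "\<forall>\<^sub>F t in sequentially. S t [prod_encode (x, y)] \<noteq> 0" if xy: "R x y" for x y
    proof -
      obtain v where "rec_eval p [prod_encode (x, y)] = Some v"
        using xy iff by blast
      then have "\<forall>\<^sub>F t in sequentially. S t [prod_encode (x, y)] = Suc v"
        using stage_complete[OF S] by simp
      then show ?thesis
        by eventually_elim simp
    qed
  qed
qed

text \<open>Take the least \<open>m\<close> for which the second set is finite. It exists because
  \<open>k\<close> qualifies, and minimality makes the first set infinite.\<close>

lemma k_bounded_maximal_size:
  assumes "equivp R" "k_bounded k R"
  obtains m where "infinite {x. m \<le> card {y. R x y}}" "finite {x. m < card {y. R x y}}"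
proof -
  let ?P = "\<lambda>m. finite {x. m < card {y. R x y}}"
  have "?P k"
    using assms(2) unfolding k_bounded_def by (simp add: not_less[symmetric])
  then have fin: "?P (LEAST m. ?P m)"
    by (rule LeastI)
  have "infinite {x. (LEAST m. ?P m) \<le> card {y. R x y}}"
  proof (cases "LEAST m. ?P m")
    case 0
    then show ?thesis
      by simp
  next
    case (Suc m)
    then have "\<not> ?P m"
      using not_less_Least[of m ?P] by simp
    then show ?thesis
      by (simp add: Suc Suc_le_eq)
  qed
  then show thesis
    using fin that by blast
qed

lemma bounded_ceer_above_omega:
  assumes "ceer R" "bounded_rel R"
  shows "reducible omega R"
proof -
  obtain D where D_rec: "total_recursive 3 (\<lambda>xs. D (arg xs 0) (arg xs 1) (arg xs 2))"
    and D_sound: "\<And>t x y. D t x y \<noteq> 0 \<Longrightarrow> R x y"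
    and D_complete: "\<And>x y. R x y \<Longrightarrow> \<forall>\<^sub>F t in sequentially. D t x y \<noteq> 0"
    using ceer_stages[OF assms(1)] by blast
  have R: "equivp R"
    using assms(1) by (simp add: ceer_def)
  obtain k where k: "k_bounded k R"
    using assms(2) unfolding bounded_rel_def by blast
  then have fin: "finite {y. R x y}" for x
    by (simp add: k_bounded_def)
  obtain m where inf: "infinite {x. m \<le> card {y. R x y}}"
    and "finite {x. m < card {y. R x y}}"
    using k_bounded_maximal_size[OF R k] by blast
  then obtain b where "\<forall>x\<in>{x. m < card {y. R x y}}. x < b"
    unfolding finite_nat_set_iff_bounded by blast
  then have b: "card {y. R x y} \<le> m" if "b \<le> x" for x
    using that by (force simp: not_less[symmetric])

  \<comment> \<open>The number of equivalents of \<open>x\<close> below \<open>t\<close> that are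
    known at stage \<open>t\<close>, as a bounded sum so as to be visibly recursive.\<close>
  define c where "c = (\<lambda>t x. \<Sum>y<t. of_bool (0 < D t x y) :: nat)"
  have c: "c t x = card {y. y < t \<and> D t x y \<noteq> 0}" for t x
    by (simp add: c_def Int_def conj_commute)
  have c_complete: "\<forall>\<^sub>F t in sequentially. m \<le> c t x" if "m \<le> card {y. R x y}" for x
  proof -
    have "\<forall>\<^sub>F t in sequentially. \<forall>y\<in>{y. R x y}. y < t \<and> D t x y \<noteq> 0"
      by (intro eventually_ball_finite fin ballI eventually_conj eventually_gt_at_top D_complete)
        simp
    then show ?thesis
    proof eventually_elim
      case (elim t)
      then have "card {y. R x y} \<le> c t x"
        unfolding c by (intro card_mono) auto
      then show ?case
        using that by simp
    qed
  qed
  \<comment> \<open>Beyond \<open>b\<close> a class has at most \<open>m\<close> elements, so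
    \<open>m\<close> known equivalents exhaust it and the stage \<open>t\<close> bounds the whole
    class.\<close>
  have c_full: "y < t" if "b \<le> x" "m \<le> c t x" "R x y" for t x y
  proof -
    have "{y. y < t \<and> D t x y \<noteq> 0} = {y. R x y}"
      using b[OF that(1)] that(2) D_sound unfolding c by (intro card_seteq fin) auto
    then show ?thesis
      using that(3) by blast
  qed

  \<comment> \<open>Conjunction as a product: positive iff \<open>x\<close> is an admissible choice
    from \<open>s\<close> on, at stage \<open>t\<close>.\<close>
  define G where "G = (\<lambda>s t x. of_bool (s < Suc x) * of_bool (m < Suc (c t x)) :: nat)"
  have G: "0 < G s t x \<longleftrightarrow> s \<le> x \<and> m \<le> c t x" for s t x
    by (auto simp: G_def)
  \<comment> \<open>The first stage \<open>t\<close> that offers an admissible choice below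
    \<open>t\<close>. The form \<open>1 - u = 0\<close> states \<open>u > 0\<close> as a search for
    a zero.\<close>
  define E where "E = (\<lambda>s. LEAST t. 1 - (\<Sum>x<t. G s t x) = 0)"
  have ex_E: "\<exists>t. 1 - (\<Sum>x<t. G s t x) = 0" for s
  proof -
    obtain x where x: "s \<le> x" "m \<le> card {y. R x y}"
      using inf unfolding finite_nat_set_iff_bounded by (force simp: not_less)
    then have "\<forall>\<^sub>F t in sequentially. m \<le> c t x \<and> x < t"
      by (intro eventually_conj c_complete eventually_gt_at_top)
    then obtain t where "m \<le> c t x" "x < t"
      by (auto simp: eventually_sequentially)
    then have "0 < G s t x" "x \<in> {..<t}"
      using x G by auto
    then have "(\<Sum>x<t. G s t x) \<noteq> 0"
      by (metis finite_lessThan less_numeral_extra(3) sum_eq_0_iff)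
    then show ?thesis
      by (intro exI[of _ t]) arith
  qed
  have E: "\<exists>x<E s. s \<le> x \<and> m \<le> c (E s) x" for s
  proof -
    have "(\<Sum>x<E s. G s (E s) x) \<noteq> 0"
      using LeastI_ex[OF ex_E[of s]] unfolding E_def by linarith
    then obtain x where "x < E s" "G s (E s) x \<noteq> 0"
      by (metis lessThan_iff sum.neutral)
    then show ?thesis
      using G by auto
  qed

  \<comment> \<open>\<open>\<tau> (Suc n)\<close> is the stage at which \<open>f n\<close> is
    accepted, and at the same time the lower bound for \<open>f (Suc n)\<close>.\<close>
  define \<tau> where "\<tau> = (\<lambda>n. rec_nat b (\<lambda>_ r. E r) n)"
  define f where "f = (\<lambda>n. LEAST x. 1 - G (\<tau> n) (\<tau> (Suc n)) x = 0)"
  have ex_f: "\<exists>x<\<tau> (Suc n). 0 < G (\<tau> n) (\<tau> (Suc n)) x" for n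
    using E[of "\<tau> n"] by (auto simp: \<tau>_def G)
  then have ex_f': "\<exists>x. 1 - G (\<tau> n) (\<tau> (Suc n)) x = 0" for n
    by (metis diff_is_0_eq less_eq_Suc_le One_nat_def)
  have f: "\<tau> n \<le> f n" "m \<le> c (\<tau> (Suc n)) (f n)" for n
  proof -
    have "0 < G (\<tau> n) (\<tau> (Suc n)) (f n)"
      using LeastI_ex[OF ex_f'[of n]] unfolding f_def by auto
    then show "\<tau> n \<le> f n" "m \<le> c (\<tau> (Suc n)) (f n)"
      by (auto simp: G)
  qed
  have "\<tau> n \<le> \<tau> (Suc n)" for n
    using ex_f[of n] by (auto simp: G)
  then have mono: "\<tau> n \<le> \<tau> n'" if "n \<le> n'" for n n'
    using that by (rule lift_Suc_mono_le)
  have b_le: "b \<le> f n" for n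
    using f(1)[of n] mono[of 0 n] by (simp add: \<tau>_def)
  \<comment> \<open>The whole class of \<open>f n\<close> lies below \<open>\<tau> (Suc n)\<close>,
    whereas \<open>f n'\<close> is at least \<open>\<tau> n'\<close>, which is no smaller.\<close>
  have sep: "\<not> R (f n) (f n')" if "n < n'" for n n'
  proof
    assume "R (f n) (f n')"
    then have "f n' < \<tau> (Suc n)"
      using c_full[OF b_le f(2)] by blast
    then show False
      using f(1)[of n'] mono[of "Suc n" n'] that by simp
  qed
  have "x = y \<longleftrightarrow> R (f x) (f y)" for x y
    using sep[of x y] sep[of y x] equivp_reflp[OF R] equivp_symp[OF R]
    by (cases x y rule: linorder_cases) auto

  moreover have "computable f"
  proof -
    have D: "total_recursive n (\<lambda>xs. D (T xs) (X xs) (Y xs))"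
      if "total_recursive n T" "total_recursive n X" "total_recursive n Y" for n T X Y
    proof -
      have "total_recursive_list n 3 (\<lambda>xs. [T xs, X xs, Y xs])"
        unfolding numeral_3_eq_3 by (intro recursive_intros that)
      from total_recursive_comp[OF D_rec this] show ?thesis
        by simp
    qed
    have "total_recursive 2 (\<lambda>xs. c (arg xs 0) (arg xs 1))"
      unfolding c_def
      by (intro recursive_intros D) (simp_all add: arg_drop recursive_intros)
    note c_rec = total_recursive_lift2[OF this]
    have G_rec: "total_recursive n (\<lambda>xs. G (A xs) (T xs) (X xs))"
      if "total_recursive n A" "total_recursive n T" "total_recursive n X" for n A T X
      unfolding G_def by (intro recursive_intros c_rec that)
    have "total_recursive 1 (\<lambda>xs. E (arg xs 0))"
      unfolding E_def
    proof (rule total_recursive_Least)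
      show "total_recursive (Suc 1)
          (\<lambda>xs. 1 - (\<Sum>x<arg xs 0. G (arg (drop 1 xs) 0) (arg xs 0) x))"
        \<comment> \<open>Accesses through \<open>drop\<close> become plain projections, to which
          the rule for \<open>arg\<close> applies.\<close>
        unfolding arg_drop
        by (intro recursive_intros G_rec) (simp_all add: arg_drop recursive_intros)
    qed (rule ex_E)
    note E_rec = total_recursive_lift1[OF this]
    have \<tau>_rec: "total_recursive n (\<lambda>xs. \<tau> (F xs))" if "total_recursive n F" for n F
      unfolding \<tau>_def by (intro recursive_intros E_rec that)
    have "total_recursive 1 (\<lambda>xs. f (arg xs 0))"
      unfolding f_def
    proof (rule total_recursive_Least)
      show "total_recursive (Suc 1)
          (\<lambda>xs. 1 - G (\<tau> (arg (drop 1 xs) 0)) (\<tau> (Suc (arg (drop 1 xs) 0))) (arg xs 0))"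
        unfolding arg_drop by (intro recursive_intros G_rec \<tau>_rec)
    qed (rule ex_f')
    then obtain p where "\<forall>xs. length xs = 1 \<longrightarrow> rec_eval p xs = Some (f (arg xs 0))"
      unfolding total_recursive_def by blast
    then have "rec_eval p [x] = Some (f x)" for x
      by simp
    then show ?thesis
      unfolding computable_def by blast
  qed
  ultimately show ?thesis
    unfolding reducible_def witnesses_def by blast
qed

theorem theorem6p2:
  shows "(\<forall>R. ceer R \<and> bounded_rel R \<longrightarrow> reducible omega R) \<and>
    (\<forall>k>1. \<not> (\<exists>\<rho>. partial_computable2 \<rho> \<and>
       (\<forall>e. k_bounded k (ceer_of e) \<longrightarrow>
          (\<forall>x. \<rho> e x \<noteq> None) \<and> witnesses (\<lambda>x. the (\<rho> e x)) omega (ceer_of e))))"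
  using bounded_ceer_above_omega no_uniform_reduction by meson

end
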